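(* Let $(m,q) = (w^a,w^b)$, where $a, b \geq 1$ are integers and $w\geq 2$ is an integer. Let $n$ be a positive integer with $n\equiv -1 \pmod{w}$. Below, $s,t$ denote non-negative integers. Then (1) there are exactly $2$ conjugate $(m,q)$-ary partitions of $n$ if $n=w^{as}+w^{bt}-1$ for some $s,t$ with $as \equiv 0 \pmod b$, $bt \equiv 0 \pmod a$, and $as\neq bt$; (2) there is exactly $1$ conjugate $(m,q)$-ary partition of $n$ if $n=w^{as}+w^{bt}-1$ for some $s,t$ for which at least one of the three conditions listed in (1) does not hold; (3) there is no conjugate $(m,q)$-ary partition of $n$ otherwise. In the first case, the two partitions are generated by the distinct sequences $M^sR^t$ and $M^{bt/a}R^{as/b}$. In the second case, $M^sR^t$ is the unique sequence that partitions the given $n$.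
   Context: Let $m,q\ge 2$ be integers. A partition $\lambda$ of a positive integer $n$ is $m$-ary if all its parts are powers $m^i$, $i\ge 0$ (so $m^0=1$ is allowed). If $a_i$ is the number of times the part $m^i$ appears in $\lambda$, one writes $\lambda=(a_k,a_{k-1},\ldots,a_0)_m$, where $a_k\neq 0$ and $a_i=0$ for $i>k$. $\lambda$ is conjugate $(m,q)$-ary if $\lambda$ is $m$-ary and its conjugate $\lambda'$ is $q$-ary; equivalently, $\lambda$ is $m$-ary and each partial sum $\sum_{i=r}^k a_i$, $0\le r\le k$, is a power of $q$ (with $q^0=1$ allowed). For a conjugate $(m,q)$-ary partition $\lambda=(a_k,\ldots,a_0)_m$, define the operators (each producing a conjugate $(m,q)$-ary partition): raise $R(\lambda)=(qa_k,\ldots,qa_0)_m$ and migration $M(\lambda)=(1,a_k-1,a_{k-1},\ldots,a_0)_m$. Sequences of operators are composed as functions (rightmost applied first); a sequence $A$ of $R$ and $M$ operators generates the partition $A(1)_m$, where $(1)_m$ is the trivial partition of $1$. *)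

theory Defs
  imports "HOL-Library.Multiset" "HOL-Number_Theory.Cong"
begin

text \<open>A partition is the multiset of its parts.\<close>

definition partition_of :: "nat multiset \<Rightarrow> nat \<Rightarrow> bool" where
  "partition_of \<pi> n \<longleftrightarrow> 0 \<notin># \<pi> \<and> sum_mset \<pi> = n"

text \<open>The conjugate has, for each \<open>j\<close> from 1 to the largest part, the part
  ``number of parts of \<open>\<pi>\<close> that are at least \<open>j\<close>'' (the length of the \<open>j\<close>-th column of
  the Young diagram). It is only meaningful for nonempty \<open>\<pi>\<close>.\<close>

definition conjugate_partition :: "nat multiset \<Rightarrow> nat multiset" where
  "conjugate_partition \<pi> =
     image_mset (\<lambda>j. size (filter_mset (\<lambda>p. j \<le> p) \<pi>)) (mset_set {1..Max_mset \<pi>})"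

definition ary :: "nat \<Rightarrow> nat multiset \<Rightarrow> bool" where
  "ary m \<pi> \<longleftrightarrow> (\<forall>p\<in>#\<pi>. \<exists>i. p = m ^ i)"

definition conj_ary :: "nat \<Rightarrow> nat \<Rightarrow> nat multiset \<Rightarrow> bool" where
  "conj_ary m q \<pi> \<longleftrightarrow> ary m \<pi> \<and> ary q (conjugate_partition \<pi>)"

definition conj_ary_partitions :: "nat \<Rightarrow> nat \<Rightarrow> nat \<Rightarrow> nat multiset set" where
  "conj_ary_partitions m q n = {\<pi>. partition_of \<pi> n \<and> conj_ary m q \<pi>}"

text \<open>\<open>from_mults m [a\<^sub>k, \<dots>, a\<^sub>0]\<close> is the partition written \<open>(a\<^sub>k, \<dots>, a\<^sub>0)\<^sub>m\<close>. The lemmas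
  \<open>raise_from_mults\<close> and \<open>migrate_from_mults\<close> below give the two operators in this notation.\<close>

fun from_mults :: "nat \<Rightarrow> nat list \<Rightarrow> nat multiset" where
  "from_mults m [] = {#}"
| "from_mults m (a # as) = replicate_mset a (m ^ length as) + from_mults m as"

definition raise_op :: "nat \<Rightarrow> nat multiset \<Rightarrow> nat multiset" where
  "raise_op q \<pi> = repeat_mset q \<pi>"

text \<open>Migration replaces one copy of the largest part \<open>m\<^sup>k\<close> by \<open>m\<^sup>k\<^sup>+\<^sup>1\<close>.\<close>

definition migrate_op :: "nat \<Rightarrow> nat multiset \<Rightarrow> nat multiset" where
  "migrate_op m \<pi> = add_mset (m * Max_mset \<pi>) (\<pi> - {#Max_mset \<pi>#})"

lemma raise_from_mults:
  "raise_op q (from_mults m as) = from_mults m (map ((*) q) as)"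
proof -
  have "repeat_mset q (from_mults m as) = from_mults m (map ((*) q) as)"
    by (induction as) (auto simp: multiset_eq_iff distrib_left)
  then show ?thesis by (simp add: raise_op_def)
qed

lemma from_mults_le:
  assumes "m \<ge> 2" and "p \<in># from_mults m as"
  shows "p < m ^ length as"
  using assms(2)
proof (induction as)
  case (Cons a as)
  have "p \<le> m ^ length as" using Cons by (auto split: if_splits)
  also have "m ^ length as < m ^ length (a # as)" using assms(1) by simp
  finally show ?case .
qed simp

lemma migrate_from_mults:
  assumes "m \<ge> 2" and "a \<noteq> 0"
  shows "migrate_op m (from_mults m (a # as)) = from_mults m (1 # (a - 1) # as)"
proof -
  obtain a' where a': "a = Suc a'" using assms(2) by (cases a) auto
  have "Max_mset (from_mults m (a # as)) = m ^ length as"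
    using assms from_mults_le[OF assms(1)]
    by (intro Max_eqI) (auto intro: less_imp_le split: if_splits)
  then show ?thesis by (simp add: migrate_op_def a')
qed

datatype operator = R | M

fun apply_operator :: "nat \<Rightarrow> nat \<Rightarrow> operator \<Rightarrow> nat multiset \<Rightarrow> nat multiset" where
  "apply_operator m q R = raise_op q"
| "apply_operator m q M = migrate_op m"

text \<open>The partition \<open>A(1)\<^sub>m\<close>. The head of the list is the leftmost operator, hence applied last.\<close>

definition generated :: "nat \<Rightarrow> nat \<Rightarrow> operator list \<Rightarrow> nat multiset" where
  "generated m q A = foldr (apply_operator m q) A (from_mults m [1])"

text \<open>The sequence \<open>M\<^sup>i R\<^sup>j\<close>.\<close>

definition MR :: "nat \<Rightarrow> nat \<Rightarrow> operator list" where
  "MR i j = replicate i M @ replicate j R"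

end

theory Submission imports Defs begin

text \<open>
  The congruence \<open>n \<equiv> -1 (mod w)\<close> leaves room for hook-shaped Young diagrams only: one part
  \<open>m\<^sup>s\<close> together with \<open>q\<^sup>t - 1\<close> parts equal to 1. Indeed, all parts of an \<open>m\<close>-ary
  partition other than 1 vanish modulo \<open>w\<close>, so \<open>n\<close> is congruent to the number of parts
  equal to 1. If there are other parts, this number is the difference of the first two column lengths of the diagram, both
  powers of \<open>q\<close>, and the difference can be \<open>-1\<close> modulo \<open>w\<close> only if the second column has
  length 1 (lemma \<open>conj_ary_imp_hook\<close>); a diagram with a single column is the hook with
  \<open>s = 0\<close>. Conversely the conjugate of a hook is the hook with arm
  and leg exchanged, so each of these hooks is conjugate \<open>(m,q)\<close>-ary, and it is generated by
  \<open>M\<^sup>s R\<^sup>t\<close>.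

  Counting partitions of \<open>n\<close> therefore means counting the pairs \<open>(s,t)\<close> with
  \<open>n + 1 = w\<^sup>a\<^sup>s + w\<^sup>b\<^sup>t\<close>. A sum of two powers of \<open>w\<close> determines the unordered pair of
  exponents (lemma \<open>power_sum_unique\<close>), so besides a given solution the only other candidate has
  the exponents \<open>as\<close> and \<open>bt\<close> interchanged. It exists when \<open>b\<close> divides \<open>as\<close> and \<open>a\<close>
  divides \<open>bt\<close>, and it is different when \<open>as \<noteq> bt\<close>.

  Uniqueness of the operator sequence comes from the same congruence, applied to words instead of
  partitions (lemma \<open>generated_minus_one\<close>).
\<close>

section \<open>Hooks\<close>

text \<open>Both arguments count the corner cell: \<open>x\<close> is the largest part and \<open>y\<close> is the number
  of parts.\<close>

definition hook :: "nat \<Rightarrow> nat \<Rightarrow> nat multiset" where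
  "hook x y = add_mset x (replicate_mset (y - 1) 1)"

lemma Max_hook: "x \<ge> 1 \<Longrightarrow> Max_mset (hook x y) = x"
  by (rule Max_eqI) (auto simp: hook_def split: if_splits)

lemma sum_hook: "y \<ge> 1 \<Longrightarrow> sum_mset (hook x y) = x + y - 1"
  by (simp add: hook_def)

lemma hook_one: "y \<ge> 1 \<Longrightarrow> hook 1 y = replicate_mset y 1"
  by (cases y) (auto simp: hook_def)

lemma conjugate_hook:
  assumes "x \<ge> 1" "y \<ge> 1"
  shows "conjugate_partition (hook x y) = hook y x"
proof -
  let ?c = "\<lambda>j. size (filter_mset (\<lambda>p. j \<le> p) (hook x y))"
  have split: "{1..x} = insert 1 {2..x}" using assms(1) by auto
  have first: "?c 1 = y"
  proof -
    have "filter_mset (\<lambda>p. 1 \<le> p) (hook x y) = hook x y"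
      using assms(1) by (subst filter_mset_eq_conv) (auto simp: hook_def split: if_splits)
    then show ?thesis using assms(2) by (simp add: hook_def)
  qed
  have other: "image_mset ?c (mset_set {2..x}) = image_mset (\<lambda>_. 1) (mset_set {2..x})"
    by (rule image_mset_cong) (auto simp: hook_def)
  have "conjugate_partition (hook x y) = add_mset (?c 1) (image_mset ?c (mset_set {2..x}))"
    unfolding conjugate_partition_def Max_hook[OF assms(1)] split by simp
  also have "\<dots> = hook y x"
    unfolding first other by (simp add: hook_def image_mset_const_eq)
  finally show ?thesis .
qed

lemma hook_conj_ary: "m \<ge> 1 \<Longrightarrow> q \<ge> 1 \<Longrightarrow> conj_ary m q (hook (m ^ s) (q ^ t))"
proof -
  have "ary k (hook (k ^ i) y)" for k i y
  proof -
    have "p = k ^ i \<or> p = k ^ 0" if "p \<in># hook (k ^ i) y" for p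
      using that by (auto simp: hook_def split: if_splits)
    then show ?thesis unfolding ary_def by blast
  qed
  then show "m \<ge> 1 \<Longrightarrow> q \<ge> 1 \<Longrightarrow> conj_ary m q (hook (m ^ s) (q ^ t))"
    by (simp add: conj_ary_def conjugate_hook)
qed

lemma partition_of_hook:
  "x \<ge> 1 \<Longrightarrow> y \<ge> 1 \<Longrightarrow> partition_of (hook x y) n \<longleftrightarrow> n + 1 = x + y"
  by (auto simp: partition_of_def sum_hook) (auto simp: hook_def split: if_splits)

section \<open>Conjugate-ary partitions of numbers congruent to -1\<close>

text \<open>An entry of the conjugate is a column length; the hypothesis on \<open>j\<close> says that column
  \<open>j\<close> is nonempty.\<close>

lemma column_is_power:
  assumes "conj_ary m q \<pi>" and "1 \<le> j" and "p \<in># \<pi>" and "j \<le> p"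
  shows "\<exists>u. size (filter_mset (\<lambda>p. j \<le> p) \<pi>) = q ^ u"
proof -
  have "p \<le> Max_mset \<pi>" using assms(3) by simp
  then have "j \<le> Max_mset \<pi>" by (rule le_trans[OF assms(4)])
  then have "j \<in> {1..Max_mset \<pi>}" using assms(2) by simp
  then show ?thesis
    using assms(1) by (auto simp: conj_ary_def ary_def conjugate_partition_def)
qed

lemma dvd_power_if_dvd:
  fixes w x :: nat
  assumes "w dvd x" and "k \<noteq> 0"
  shows "w dvd x ^ k"
  using assms by (cases k) auto

text \<open>Modulo \<open>w\<close>, the sum of an \<open>m\<close>-ary partition only sees the parts equal to 1.\<close>

lemma sum_mset_mod_ones:
  assumes "\<And>p. p \<in># \<pi> \<Longrightarrow> p = 1 \<or> w dvd p"
  shows "[sum_mset \<pi> = count \<pi> 1] (mod w)"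
  using assms
proof (induction \<pi>)
  case (add p \<pi>)
  then have IH: "[sum_mset \<pi> = count \<pi> 1] (mod w)" by auto
  show ?case
  proof (cases "p = 1")
    case True
    then show ?thesis using cong_add[OF cong_refl[of 1] IH] by simp
  next
    case False
    then have "[p = 0] (mod w)" using add.prems[of p] by (auto simp: cong_0_iff)
    then show ?thesis using cong_add[OF _ IH, of p 0] False by simp
  qed
qed simp

text \<open>The two column lengths are \<open>q\<^sup>u\<close> (all parts) and \<open>q\<^sup>v\<close> (parts different from 1).
  If \<open>v > 0\<close> then \<open>w\<close> would divide both of them, hence also the number of parts equal to 1
  and, since this is congruent to it, \<open>n\<close> itself, contrary to \<open>w dvd n + 1\<close>.\<close>

lemma conj_ary_imp_hook:
  assumes part: "partition_of \<pi> n" and conj: "conj_ary m q \<pi>"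
    and "n > 0" and "w \<ge> 2" and n: "w dvd n + 1" and "w dvd m" and "w dvd q"
  shows "\<exists>s t. \<pi> = hook (m ^ s) (q ^ t)"
proof -
  have pos: "p \<ge> 1" if "p \<in># \<pi>" for p
    using part that by (cases p) (auto simp: partition_of_def)
  have pow: "\<exists>i. p = m ^ i" if "p \<in># \<pi>" for p
    using conj that by (auto simp: conj_ary_def ary_def)
  obtain p0 where p0: "p0 \<in># \<pi>"
    using part \<open>n > 0\<close> by (cases \<pi>) (auto simp: partition_of_def)
  have all: "filter_mset (\<lambda>p. 1 \<le> p) \<pi> = \<pi>"
    using pos by (simp add: filter_mset_eq_conv)
  obtain u where u: "size \<pi> = q ^ u"
    using column_is_power[OF conj _ p0 pos[OF p0]] all by auto
  \<comment> \<open>The size of \<open>\<rho>\<close> is the length of the second column; it may be 0.\<close>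
  define \<rho> where "\<rho> = filter_mset (\<lambda>p. 2 \<le> p) \<pi>"
  have "filter_mset (\<lambda>p. \<not> 2 \<le> p) \<pi> = filter_mset (\<lambda>p. p = 1) \<pi>"
    by (rule filter_mset_cong) (use pos in force)+
  then have ones: "filter_mset (\<lambda>p. \<not> 2 \<le> p) \<pi> = replicate_mset (count \<pi> 1) 1"
    by (simp add: filter_eq_replicate_mset)
  have split: "\<pi> = \<rho> + replicate_mset (count \<pi> 1) 1"
    unfolding \<rho>_def using multiset_partition[of \<pi> "\<lambda>p. 2 \<le> p"] ones by simp
  have size: "q ^ u = size \<rho> + count \<pi> 1"
    using arg_cong[OF split, of size] u by simp
  show ?thesis
  proof (cases "\<rho> = {#}")
    case True
    then have "\<pi> = replicate_mset (q ^ u) 1" using split size by simp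
    moreover have "q ^ u \<ge> 1" using p0 u by (cases \<pi>) auto
    ultimately have "\<pi> = hook (m ^ 0) (q ^ u)" using hook_one by simp
    then show ?thesis by blast
  next
    case False
    then obtain r where r: "r \<in># \<rho>" by blast
    then have "r \<in># \<pi>" "2 \<le> r" by (auto simp: \<rho>_def)
    then obtain v where v: "size \<rho> = q ^ v"
      using column_is_power[OF conj, of 2 r] by (auto simp: \<rho>_def)
    have "v = 0"
    proof (rule ccontr)
      assume "v \<noteq> 0"
      then have wv: "w dvd q ^ v" using \<open>w dvd q\<close> by (simp add: dvd_power_if_dvd)
      \<comment> \<open>The first column is at least as long as the second, so its length is not 1 either.\<close>
      have "u \<noteq> 0"
      proof
        assume "u = 0"
        then have "size \<rho> + count \<pi> 1 = 1" using size by simp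
        moreover have "size \<rho> \<noteq> 0" using False by simp
        ultimately have "size \<rho> = 1" by linarith
        then have "w dvd 1" using v wv by (simp only:)
        then show False using \<open>w \<ge> 2\<close> by simp
      qed
      then have wu: "w dvd q ^ u" using \<open>w dvd q\<close> by (simp add: dvd_power_if_dvd)
      have "w dvd count \<pi> 1"
        using size v wu wv by (metis dvd_add_right_iff)
      moreover have "[n = count \<pi> 1] (mod w)"
      proof -
        have "p = 1 \<or> w dvd p" if p: "p \<in># \<pi>" for p
        proof -
          obtain i where i: "p = m ^ i" using pow[OF p] by blast
          show ?thesis using i \<open>w dvd m\<close> by (cases i) auto
        qed
        then show ?thesis using sum_mset_mod_ones part by (auto simp: partition_of_def)
      qed
      ultimately have "w dvd n" by (simp add: cong_dvd_iff)
      then have "w dvd 1" using n by (metis dvd_add_right_iff)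
      then show False using \<open>w \<ge> 2\<close> by simp
    qed
    then have "\<rho> = {#r#}"
      using v r size_1_singleton_mset[of \<rho>] by auto
    moreover obtain i where "r = m ^ i" using pow \<open>r \<in># \<pi>\<close> by blast
    moreover have "count \<pi> 1 = q ^ u - 1" using size v \<open>v = 0\<close> by simp
    ultimately have "\<pi> = hook (m ^ i) (q ^ u)" using split by (simp add: hook_def)
    then show ?thesis by blast
  qed
qed

section \<open>Operator sequences\<close>

lemma raise_hook:
  assumes "q \<ge> 1" "y \<ge> 1"
  shows "raise_op q (hook 1 y) = hook 1 (q * y)"
proof -
  have "q * y \<ge> 1" using assms by simp
  then show ?thesis
    using hook_one[OF assms(2)] hook_one[of "q * y"]
    by (auto simp: raise_op_def multiset_eq_iff)
qed

lemma migrate_hook: "x \<ge> 1 \<Longrightarrow> migrate_op m (hook x y) = hook (m * x) y"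
  by (simp add: migrate_op_def Max_hook) (simp add: hook_def)

lemma generated_simps [simp]:
  "generated m q [] = {#1#}"
  "generated m q (R # A) = raise_op q (generated m q A)"
  "generated m q (M # A) = migrate_op m (generated m q A)"
  by (simp_all add: generated_def)

lemma generated_MR:
  assumes "m \<ge> 1" "q \<ge> 1"
  shows "generated m q (MR s t) = hook (m ^ s) (q ^ t)"
proof (induction s)
  case 0
  show ?case
  proof (induction t)
    case (Suc t)
    then show ?case using raise_hook[of q "q ^ t"] assms by (simp add: MR_def)
  qed (simp add: MR_def hook_def)
next
  case (Suc s)
  then show ?case using migrate_hook[of "m ^ s" m] assms by (simp add: MR_def)
qed

text \<open>The largest part is what a leftmost \<open>M\<close> multiplies, so it controls the change of the sum
  under migration. Nonemptiness is carried along because \<open>Max_mset\<close> is undefined on \<open>{#}\<close>.\<close>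

lemma Max_generated:
  assumes "m \<ge> 1" "q \<ge> 1"
  shows "generated m q A \<noteq> {#} \<and> Max_mset (generated m q A) = m ^ count_list A M"
proof (induction A)
  case (Cons x A)
  let ?\<pi> = "generated m q A"
  show ?case
  proof (cases x)
    case R
    have "set_mset (repeat_mset q ?\<pi>) = set_mset ?\<pi>"
      using assms(2)
      by (intro set_eqI)
        (simp add: count_greater_zero_iff[symmetric] del: count_greater_zero_iff)
    moreover from this have "repeat_mset q ?\<pi> \<noteq> {#}"
      using Cons.IH by (metis set_mset_eq_empty_iff)
    ultimately show ?thesis using Cons.IH R by (simp add: raise_op_def)
  next
    case M
    have le: "p \<le> m * Max_mset ?\<pi>" if "p \<in># ?\<pi>" for p
    proof -
      have "p \<le> Max_mset ?\<pi>" using that by (intro Max_ge) simp_all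
      with assms(1) have "1 * p \<le> m * Max_mset ?\<pi>" by (rule mult_le_mono)
      then show ?thesis by (simp only: mult_1)
    qed
    have "Max_mset (migrate_op m ?\<pi>) = m * Max_mset ?\<pi>"
      unfolding migrate_op_def by (rule Max_eqI) (auto dest: in_diffD intro: le)
    moreover have "migrate_op m ?\<pi> \<noteq> {#}" by (simp add: migrate_op_def)
    ultimately show ?thesis using Cons.IH M by simp
  qed
qed simp

lemma sum_migrate:
  assumes "\<pi> \<noteq> {#}"
  shows "sum_mset (migrate_op m \<pi>) + Max_mset \<pi> = sum_mset \<pi> + m * Max_mset \<pi>"
proof -
  have "Max_mset \<pi> \<in># \<pi>" using assms(1) by simp
  from arg_cong[OF insert_DiffM[OF this], of sum_mset]
  have "sum_mset \<pi> = Max_mset \<pi> + sum_mset (\<pi> - {#Max_mset \<pi>#})"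
    unfolding sum_mset.add_mset by (rule sym)
  moreover have "sum_mset (migrate_op m \<pi>) = m * Max_mset \<pi> + sum_mset (\<pi> - {#Max_mset \<pi>#})"
    by (simp add: migrate_op_def)
  ultimately show ?thesis by linarith
qed

text \<open>A leftmost \<open>R\<close> makes the sum divisible by \<open>w\<close>. A leftmost \<open>M\<close> changes the sum by
  \<open>(m - 1) m\<^sup>c\<close>, where \<open>c\<close> counts the letters \<open>M\<close> already applied. For \<open>c > 0\<close> this is
  divisible by \<open>w\<close>, so the remaining word also generates a partition of a number congruent to
  \<open>-1\<close>; for \<open>c = 0\<close> the remaining word is a power of \<open>R\<close>.\<close>

lemma generated_minus_one:
  assumes "w \<ge> 2" and "m \<ge> 1" and "q \<ge> 1" and "w dvd m" and "w dvd q"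
    and "w dvd sum_mset (generated m q A) + 1"
  shows "\<exists>s t. A = MR s t"
  using assms(6)
proof (induction A)
  case Nil
  have "[] = MR 0 0" by (simp add: MR_def)
  then show ?case by blast
next
  case (Cons x A)
  let ?\<pi> = "generated m q A"
  show ?case
  proof (cases x)
    case R
    have "sum_mset (repeat_mset k ?\<pi>) = k * sum_mset ?\<pi>" for k
      by (induction k) auto
    then have "w dvd sum_mset (generated m q (x # A))"
      using R \<open>w dvd q\<close> by (simp add: raise_op_def)
    then have "w dvd 1" using Cons.prems by (metis dvd_add_right_iff)
    then show ?thesis using \<open>w \<ge> 2\<close> by simp
  next
    case M
    show ?thesis
    proof (cases "M \<in> set A")
      case True
      then have "count_list A M \<noteq> 0" by (simp add: count_list_0_iff)
      then have wMax: "w dvd Max_mset ?\<pi>"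
        using Max_generated[OF assms(2,3), of A] \<open>w dvd m\<close> by (simp add: dvd_power_if_dvd)
      have "w dvd (sum_mset (migrate_op m ?\<pi>) + 1) + Max_mset ?\<pi>"
        using dvd_add[OF Cons.prems wMax] M by simp
      then have "w dvd (sum_mset ?\<pi> + 1) + m * Max_mset ?\<pi>"
        using sum_migrate[of ?\<pi> m] Max_generated[OF assms(2,3), of A]
        by (simp add: add.commute add.left_commute)
      then have "w dvd sum_mset ?\<pi> + 1"
        using wMax by (metis dvd_add_left_iff dvd_mult)
      then obtain s t where "A = MR s t" using Cons.IH by blast
      then have "x # A = MR (Suc s) t" using M by (simp add: MR_def)
      then show ?thesis by blast
    next
      case False
      then have "\<forall>y\<in>set A. y = R" by (metis operator.exhaust)
      then have "A = replicate (length A) R" by (simp add: replicate_length_same)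
      then have "x # A = MR 1 (length A)" using M by (simp add: MR_def)
      then show ?thesis by blast
    qed
  qed
qed

section \<open>Sums of two powers\<close>

text \<open>The larger exponent \<open>y\<close> is determined by \<open>w\<^sup>y < N \<le> 2 w\<^sup>y \<le> w\<^sup>y\<^sup>+\<^sup>1\<close>, where
  \<open>N\<close> is the sum.\<close>

lemma power_sum_unique:
  fixes w :: nat
  assumes "w \<ge> 2" and "w ^ x + w ^ y = w ^ u + w ^ v"
  shows "(x = u \<and> y = v) \<or> (x = v \<and> y = u)"
proof -
  have no_less: "\<not> y < v"
    if "x \<le> y" "w ^ x + w ^ y = w ^ u + w ^ v" for x y u v
  proof
    assume "y < v"
    have "w ^ x \<le> w ^ y" using that assms by (intro power_increasing) auto
    then have "w ^ x + w ^ y \<le> 2 * w ^ y" by simp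
    also have "\<dots> \<le> w ^ Suc y" using assms(1) by simp
    also have "\<dots> \<le> w ^ v" using \<open>y < v\<close> assms(1) by (intro power_increasing) auto
    also have "\<dots> < w ^ u + w ^ v" using assms(1) by simp
    finally show False using that by simp
  qed
  have ordered: "x = u \<and> y = v"
    if "x \<le> y" "u \<le> v" and eq: "w ^ x + w ^ y = w ^ u + w ^ v" for x y u v
  proof -
    have "y = v"
      using no_less[OF that(1) eq] no_less[OF that(2) eq[symmetric]] by simp
    then show ?thesis using eq assms(1) by simp
  qed
  show ?thesis
    using ordered[of x y u v] ordered[of y x u v] ordered[of x y v u] ordered[of y x v u]
      assms(2) linear[of x y] linear[of u v] by (simp add: add.commute) blast
qed

section \<open>The classification\<close>

theorem theorem6p1:
  fixes w a b m q n :: nat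
  assumes "w \<ge> 2" and "a \<ge> 1" and "b \<ge> 1"
    and "m = w ^ a" and "q = w ^ b"
    and "n > 0" and "[int n = -1] (mod int w)"
  shows
    "(\<forall>s t. n = w ^ (a * s) + w ^ (b * t) - 1 \<and>
        [a * s = 0] (mod b) \<and> [b * t = 0] (mod a) \<and> a * s \<noteq> b * t \<longrightarrow>
        card (conj_ary_partitions m q n) = 2 \<and>
        MR s t \<noteq> MR (b * t div a) (a * s div b) \<and>
        conj_ary_partitions m q n =
          {generated m q (MR s t), generated m q (MR (b * t div a) (a * s div b))}) \<and>
     (\<forall>s t. n = w ^ (a * s) + w ^ (b * t) - 1 \<and>
        \<not> ([a * s = 0] (mod b) \<and> [b * t = 0] (mod a) \<and> a * s \<noteq> b * t) \<longrightarrow>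
        card (conj_ary_partitions m q n) = 1 \<and>
        conj_ary_partitions m q n = {generated m q (MR s t)} \<and>
        (\<forall>A. partition_of (generated m q A) n \<longleftrightarrow> A = MR s t)) \<and>
     ((\<nexists>s t. n = w ^ (a * s) + w ^ (b * t) - 1) \<longrightarrow>
        conj_ary_partitions m q n = {})"
proof -
  have m: "m \<ge> 1" "w dvd m" and q: "q \<ge> 1" "w dvd q"
    using assms by (auto intro: dvd_power)
  have "int w dvd int (n + 1)"
    using assms(7) by (simp add: cong_iff_dvd_diff add.commute)
  then have n: "w dvd n + 1" by (simp only: int_dvd_int_iff)
  define Sol where "Sol s t \<longleftrightarrow> n + 1 = m ^ s + q ^ t" for s t
  have Sol: "n = w ^ (a * s) + w ^ (b * t) - 1 \<longleftrightarrow> Sol s t" for s t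
  proof -
    have "w ^ (a * s) \<ge> 1" using assms(1) by simp
    then show ?thesis unfolding Sol_def assms(4,5) power_mult[symmetric] by linarith
  qed
  have parts: "conj_ary_partitions m q n = {\<pi>. \<exists>s t. \<pi> = generated m q (MR s t) \<and> Sol s t}"
  proof -
    have "partition_of (hook (m ^ s) (q ^ t)) n \<longleftrightarrow> Sol s t" for s t
      using m(1) q(1) by (simp add: partition_of_hook Sol_def)
    then show ?thesis
      using conj_ary_imp_hook[OF _ _ assms(6,1) n m(2) q(2)] hook_conj_ary[OF m(1) q(1)]
      unfolding conj_ary_partitions_def generated_MR[OF m(1) q(1)] by blast
  qed
  have words: "partition_of (generated m q A) n \<longleftrightarrow> (\<exists>s t. A = MR s t \<and> Sol s t)" for A
  proof
    assume A: "partition_of (generated m q A) n"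
    then obtain s t where st: "A = MR s t"
      using generated_minus_one[OF assms(1) m(1) q(1) m(2) q(2), of A] n
      by (auto simp: partition_of_def)
    then show "\<exists>s t. A = MR s t \<and> Sol s t"
      using A m(1) q(1) by (auto simp: generated_MR partition_of_hook Sol_def)
  next
    assume "\<exists>s t. A = MR s t \<and> Sol s t"
    then show "partition_of (generated m q A) n"
      using m(1) q(1) by (auto simp: generated_MR partition_of_hook Sol_def)
  qed
  have Sol_unique: "(a * s' = a * s \<and> b * t' = b * t) \<or> (a * s' = b * t \<and> b * t' = a * s)"
    if "Sol s t" "Sol s' t'" for s t s' t'
    using that power_sum_unique[OF assms(1), of "a * s'" "b * t'" "a * s" "b * t"]
    unfolding Sol_def assms(4,5) power_mult[symmetric] by simp
  \<comment> \<open>The second solution has the exponents of \<open>w\<close> interchanged: \<open>a s' = b t\<close> and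
    \<open>b t' = a s\<close>.\<close>
  have two: "card (conj_ary_partitions m q n) = 2 \<and>
        MR s t \<noteq> MR (b * t div a) (a * s div b) \<and>
        conj_ary_partitions m q n =
          {generated m q (MR s t), generated m q (MR (b * t div a) (a * s div b))}"
    if st: "Sol s t" and "b dvd a * s" and "a dvd b * t" and ne: "a * s \<noteq> b * t" for s t
  proof -
    define s' t' where "s' = b * t div a" and "t' = a * s div b"
    have s': "a * s' = b * t" and t': "b * t' = a * s"
      using that by (simp_all add: s'_def t'_def)
    have "Sol s' t'"
      using st unfolding Sol_def assms(4,5) power_mult[symmetric] s' t' by simp
    moreover have "(s'' = s \<and> t'' = t) \<or> (s'' = s' \<and> t'' = t')" if "Sol s'' t''" for s'' t''
    proof -
      have "(a * s'' = a * s \<and> b * t'' = b * t) \<or> (a * s'' = a * s' \<and> b * t'' = b * t')"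
        using Sol_unique[OF st that] unfolding s' t' .
      then show ?thesis using assms(2,3) by simp
    qed
    ultimately have eq: "conj_ary_partitions m q n =
        {generated m q (MR s t), generated m q (MR s' t')}"
      unfolding parts using st by blast
    have "m ^ s \<noteq> m ^ s'"
      using ne s' assms(1) unfolding assms(4) power_mult[symmetric] by simp
    then have "Max_mset (hook (m ^ s) (q ^ t)) \<noteq> Max_mset (hook (m ^ s') (q ^ t'))"
      using m(1) by (simp add: Max_hook)
    then have diff: "generated m q (MR s t) \<noteq> generated m q (MR s' t')"
      unfolding generated_MR[OF m(1) q(1)] by metis
    then show ?thesis using eq unfolding s'_def t'_def by auto
  qed
  \<comment> \<open>Interchanging the exponents either gives no solution or gives back \<open>(s,t)\<close>.\<close>
  have one: "card (conj_ary_partitions m q n) = 1 \<and>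
        conj_ary_partitions m q n = {generated m q (MR s t)} \<and>
        (\<forall>A. partition_of (generated m q A) n \<longleftrightarrow> A = MR s t)"
    if st: "Sol s t" and fail: "\<not> (b dvd a * s \<and> a dvd b * t \<and> a * s \<noteq> b * t)" for s t
  proof -
    have unique: "s' = s \<and> t' = t" if "Sol s' t'" for s' t'
    proof -
      have "a * s' = a * s \<and> b * t' = b * t"
        using Sol_unique[OF st that] fail by (metis dvd_triv_left)
      then show ?thesis using assms(2,3) by simp
    qed
    have "conj_ary_partitions m q n = {generated m q (MR s t)}"
      unfolding parts using unique st by blast
    moreover have "\<forall>A. partition_of (generated m q A) n \<longleftrightarrow> A = MR s t"
      unfolding words using unique st by blast
    ultimately show ?thesis by simp
  qed
  show ?thesis
    unfolding Sol cong_0_iff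
  proof (rule conjI[OF _ conjI], goal_cases)
    case 1
    show ?case by (intro allI impI two) simp_all
  next
    case 2
    show ?case by (intro allI impI one) simp_all
  next
    case 3
    show ?case unfolding parts by blast
  qed
qed

end
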